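(* For a pattern $\tau$ let $A_\tau(x)=\sum_{n\ge0}|\mathfrak D^1_{2n}(1342,1423,\tau)|\,x^n$. (1) If $\tau'\in\mathfrak S_{\ell-1}$ ($\ell\ge2$) is not decreasing-decomposable, $\tau'_{\ell-1}\ne\ell-1$, and $\tau=\tau'\ell$, then \[ A_\tau(x)=1+\frac{x(A_{\tau'}(x))^2}{1-xA_{\tau'}(x)}. \] (2) If $\tau=\tau'(\ell-1)\ell\in\mathfrak S_\ell$, with no restrictions on $\tau'\in\mathfrak S_{\ell-2}$, then \[ A_\tau(x)=1+\frac{x(A_{\tau'(\ell-1)}(x))^2}{1-xA_{\tau'}(x)}. \] (3) If $\tau=\tau'\ell(\ell-1)\in\mathfrak S_\ell$, with no restrictions on $\tau'\in\mathfrak S_{\ell-2}$, then \[ A_\tau(x)=\frac{1+x(1-A_{\tau'}(x))-\sqrt{(1+x(1-A_{\tau'}(x)))^2-4x}}{2x}. \]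
   Context: A permutation $\sigma\in\mathfrak S_N$ contains a pattern $\tau\in\mathfrak S_k$ if there are positions $i_1<\dots<i_k$ such that $(\sigma(i_1),\dots,\sigma(i_k))$ is order-isomorphic to $\tau$; otherwise $\sigma$ avoids $\tau$. (The empty pattern is contained in every permutation, so $A_{\emptyset}(x)=0$.) A Dumont permutation of the first kind is a permutation $\pi\in\mathfrak S_{2n}$ such that for every $i=1,\dots,2n$: if $\pi(i)$ is even then $i<2n$ and $\pi(i)>\pi(i+1)$; if $\pi(i)$ is odd then $i=2n$ or $\pi(i)<\pi(i+1)$. $\mathfrak D^1_{2n}(T)$ denotes the set of Dumont permutations of the first kind of length $2n$ avoiding all listed patterns $T$ (for $n=0$ the only Dumont permutation is the empty one). Patterns are written in one-line notation, juxtaposition being concatenation: $\tau'\ell$ is $\tau'$ followed by the letter $\ell$, $\tau'(\ell-1)\ell$ is $\tau'$ followed by $\ell-1$ and then $\ell$, etc. A permutation $\tau$ is decreasing-decomposable if $\tau=\tau'\tau''$ for nonempty words $\tau',\tau''$ such that each entry of $\tau'$ is bigger than each entry of $\tau''$. Identities are of formal power series in $x$; the square root has constant term $1$. *)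

theory Defs
  imports
    "HOL-Computational_Algebra.Formal_Power_Series"
    "HOL-Combinatorics.Multiset_Permutations"
begin

text \<open>Permutations of \<open>{1..N}\<close> are represented by their one-line notation, so that
  juxtaposition of words is list append. List positions are counted from \<open>0\<close>, i.e. the
  mathematical entry \<open>\<pi>(i)\<close> is \<open>\<pi> ! (i - 1)\<close>.\<close>

definition perms :: "nat \<Rightarrow> nat list set" where
  "perms N = permutations_of_set {1..N}"

text \<open>The function \<open>p\<close> lists the positions of an occurrence in increasing order. The empty
  pattern is contained in every permutation.\<close>

definition contains_pattern :: "nat list \<Rightarrow> nat list \<Rightarrow> bool" where
  "contains_pattern \<sigma> \<tau> \<longleftrightarrow>
     (\<exists>p. strict_mono_on {..<length \<tau>} p \<and>
          (\<forall>a<length \<tau>. p a < length \<sigma>) \<and>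
          (\<forall>a<length \<tau>. \<forall>b<length \<tau>. \<sigma> ! p a < \<sigma> ! p b \<longleftrightarrow> \<tau> ! a < \<tau> ! b))"

definition avoids_pattern :: "nat list \<Rightarrow> nat list \<Rightarrow> bool" where
  "avoids_pattern \<sigma> \<tau> \<longleftrightarrow> \<not> contains_pattern \<sigma> \<tau>"

definition dumont1 :: "nat \<Rightarrow> nat list set" where
  "dumont1 n = {\<pi> \<in> perms (2 * n). \<forall>i<2 * n.
     (even (\<pi> ! i) \<longrightarrow> Suc i < 2 * n \<and> \<pi> ! i > \<pi> ! Suc i) \<and>
     (odd (\<pi> ! i) \<longrightarrow> Suc i = 2 * n \<or> \<pi> ! i < \<pi> ! Suc i)}"

definition dumont1_avoiding :: "nat \<Rightarrow> nat list set \<Rightarrow> nat list set" where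
  "dumont1_avoiding n T = {\<pi> \<in> dumont1 n. \<forall>\<tau>\<in>T. avoids_pattern \<pi> \<tau>}"

definition decreasing_decomposable :: "nat list \<Rightarrow> bool" where
  "decreasing_decomposable \<tau> \<longleftrightarrow>
     (\<exists>u v. \<tau> = u @ v \<and> u \<noteq> [] \<and> v \<noteq> [] \<and> (\<forall>a\<in>set u. \<forall>b\<in>set v. a > b))"

definition avoid_gf :: "nat list \<Rightarrow> real fps" where
  "avoid_gf \<tau> = Abs_fps (\<lambda>n. real (card (dumont1_avoiding n {[1,3,4,2], [1,4,2,3], \<tau>})))"

text \<open>The constant term of the result is the real square root of the constant term of the
  argument; in particular it is \<open>1\<close> if the argument has constant term \<open>1\<close>.\<close>

definition fps_sqrt :: "real fps \<Rightarrow> real fps" where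
  "fps_sqrt f = fps_radical root 2 f"

end

theory Submission
  imports Defs "HOL-Library.Sublist"
begin

text \<open>
  Let \<open>w\<close> be a Dumont permutation of length \<open>2n \<ge> 2\<close> avoiding \<open>1342\<close> and \<open>1423\<close>. The letter
  \<open>2n - 1\<close> is either last or immediately followed by \<open>2n\<close>. In the first case
  \<open>w = \<alpha> (2n) \<beta> (2n-1)\<close>, and avoiding \<open>1423\<close> forces every letter of \<open>\<alpha>\<close> above every letter of
  \<open>\<beta>\<close>; in the second case \<open>w = \<alpha> (2n-1) (2n) \<beta>\<close> with \<open>\<beta>\<close> nonempty, and avoiding \<open>1342\<close> has the
  same consequence. The step condition makes \<open>\<beta>\<close> and the reduced \<open>\<alpha>\<close> Dumont permutations of even
  length, both avoiding \<open>1342\<close> and \<open>1423\<close>, and every such pair occurs. An occurrence of a pattern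
  that is not decreasing-decomposable cannot straddle \<open>\<alpha>\<close> and \<open>\<beta>\<close>, so for each of the three
  shapes of \<open>\<tau>\<close> the avoidance of \<open>\<tau>\<close> splits into conditions \<open>\<tau>\<^sub>1, \<tau>\<^sub>2\<close> on the pair
  \<open>(\<alpha>, \<beta>)\<close> in the first case and \<open>\<tau>\<^sub>3, \<tau>\<close> in the second, which gives
  \<open>A\<^sub>\<tau> = 1 + x A\<^bsub>\<tau>1\<^esub> A\<^bsub>\<tau>2\<^esub> + x A\<^bsub>\<tau>3\<^esub> (A\<^sub>\<tau> - 1)\<close>.
\<close>

unbundle fps_syntax

section \<open>Pattern containment through subsequences\<close>

definition order_iso :: "nat list \<Rightarrow> nat list \<Rightarrow> bool" where
  "order_iso s t \<longleftrightarrow> length s = length t \<and>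
     (\<forall>a<length t. \<forall>b<length t. s ! a < s ! b \<longleftrightarrow> t ! a < t ! b)"

definition above :: "nat list \<Rightarrow> nat list \<Rightarrow> bool" where
  "above u v \<longleftrightarrow> (\<forall>a\<in>set u. \<forall>b\<in>set v. b < a)"

lemma subseq_imp_set_subset: "subseq s w \<Longrightarrow> set s \<subseteq> set w"
  by (auto simp: subseq_conv_nths dest: in_set_nthsD)

text \<open>Cutting \<open>xs\<close> at the last chosen position \<open>p k\<close> leaves all
  earlier positions in the prefix, so the induction goes over shorter prefixes.\<close>

lemma subseq_nth_strict_mono:
  assumes "strict_mono_on {..<k} p" "\<forall>a<k. p a < length xs"
  shows "subseq (map (\<lambda>a. xs ! p a) [0..<k]) xs"
  using assms
proof (induction k arbitrary: xs)
  case (Suc k)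
  have less: "p a < p k" if "a < k" for a
    using Suc.prems(1) that by (auto simp: strict_mono_on_def)
  have pk: "p k < length xs"
    using Suc.prems(2) by simp
  have "strict_mono_on {..<k} p"
    using Suc.prems(1) by (auto simp: strict_mono_on_def)
  moreover have "\<forall>a<k. p a < length (take (p k) xs)"
    using less pk by simp
  ultimately have "subseq (map (\<lambda>a. take (p k) xs ! p a) [0..<k]) (take (p k) xs)"
    by (rule Suc.IH)
  moreover have "map (\<lambda>a. take (p k) xs ! p a) [0..<k] = map (\<lambda>a. xs ! p a) [0..<k]"
    using less by simp
  moreover have "subseq [xs ! p k] (drop (p k) xs)"
    using pk by (simp add: subseq_singleton_left Cons_nth_drop_Suc[symmetric])
  ultimately have "subseq (map (\<lambda>a. xs ! p a) [0..<k] @ [xs ! p k]) (take (p k) xs @ drop (p k) xs)"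
    by (intro list_emb_append_mono) simp_all
  then show ?case
    by simp
qed simp

lemma subseq_imp_strict_mono:
  assumes "subseq s xs"
  shows "\<exists>p. strict_mono_on {..<length s} p \<and>
           (\<forall>a<length s. p a < length xs \<and> s ! a = xs ! p a)"
  using assms
proof (induction s xs rule: list_emb.induct)
  case (list_emb_Nil ys)
  show ?case by (simp add: strict_mono_on_def)
next
  case (list_emb_Cons xs ys y)
  then obtain p where "strict_mono_on {..<length xs} p"
    "\<forall>a<length xs. p a < length ys \<and> xs ! a = ys ! p a" by blast
  then show ?case
    by (intro exI[of _ "\<lambda>a. Suc (p a)"]) (auto simp: strict_mono_on_def)
next
  case (list_emb_Cons2 x y xs ys)
  then obtain p where "strict_mono_on {..<length xs} p"
    "\<forall>a<length xs. p a < length ys \<and> xs ! a = ys ! p a" by blast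
  then show ?case using list_emb_Cons2
    by (intro exI[of _ "\<lambda>a. case a of 0 \<Rightarrow> 0 | Suc b \<Rightarrow> Suc (p b)"])
       (auto simp: strict_mono_on_def nth_Cons split: nat.splits)
qed

text \<open>Replacing position maps by lists of chosen letters lets an occurrence be cut along
  \<open>@\<close>; every later argument about patterns does this.\<close>

lemma contains_pattern_iff_subseq:
  "contains_pattern w t \<longleftrightarrow> (\<exists>s. subseq s w \<and> order_iso s t)"
proof
  assume "contains_pattern w t"
  then obtain p where p: "strict_mono_on {..<length t} p" "\<forall>a<length t. p a < length w"
    "\<forall>a<length t. \<forall>b<length t. w ! p a < w ! p b \<longleftrightarrow> t ! a < t ! b"
    unfolding contains_pattern_def by blast
  then show "\<exists>s. subseq s w \<and> order_iso s t"
    by (intro exI[of _ "map (\<lambda>a. w ! p a) [0..<length t]"] conjI subseq_nth_strict_mono)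
       (auto simp: order_iso_def)
next
  assume "\<exists>s. subseq s w \<and> order_iso s t"
  then obtain s where s: "subseq s w" "order_iso s t" by blast
  obtain p where "strict_mono_on {..<length s} p"
    "\<forall>a<length s. p a < length w \<and> s ! a = w ! p a"
    using subseq_imp_strict_mono[OF s(1)] by blast
  then show "contains_pattern w t"
    using s(2) unfolding contains_pattern_def order_iso_def by (intro exI[of _ p]) auto
qed

lemma contains_pattern_subseq:
  "subseq v w \<Longrightarrow> contains_pattern v t \<Longrightarrow> contains_pattern w t"
  unfolding contains_pattern_iff_subseq by (meson subseq_order.trans)

lemma contains_pattern_Nil [simp]: "contains_pattern w []"
  by (auto simp: contains_pattern_def strict_mono_on_def)

lemma contains_pattern_of_Nil [simp]: "contains_pattern [] t \<longleftrightarrow> t = []"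
  by (auto simp: contains_pattern_def strict_mono_on_def)

lemma contains_pattern_map_add [simp]:
  "contains_pattern (map ((+) k) w) t \<longleftrightarrow> contains_pattern w t"
proof -
  have "(\<forall>a<length t. \<forall>b<length t. map ((+) k) w ! p a < map ((+) k) w ! p b \<longleftrightarrow> t ! a < t ! b)
     \<longleftrightarrow> (\<forall>a<length t. \<forall>b<length t. w ! p a < w ! p b \<longleftrightarrow> t ! a < t ! b)"
    if "\<forall>a<length t. p a < length w" for p
    using that by auto
  then show ?thesis
    unfolding contains_pattern_def length_map by blast
qed

lemma order_iso_snoc:
  "order_iso (s @ [m]) (t @ [l]) \<longleftrightarrow> order_iso s t \<and>
     (\<forall>i<length t. (s ! i < m \<longleftrightarrow> t ! i < l) \<and> (m < s ! i \<longleftrightarrow> l < t ! i))"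
proof (cases "length s = length t")
  case True
  have "(\<forall>a<Suc n. \<forall>b<Suc n. R a b) \<longleftrightarrow>
      (\<forall>a<n. \<forall>b<n. R a b) \<and> (\<forall>i<n. R i n \<and> R n i) \<and> R n n" for n and R :: "nat \<Rightarrow> nat \<Rightarrow> bool"
    by (auto simp: less_Suc_eq)
  then show ?thesis
    using True by (simp add: order_iso_def nth_append cong: conj_cong)
qed (simp add: order_iso_def)

lemma order_iso_snoc_max:
  assumes "\<forall>x\<in>set t. x < l"
  shows "order_iso s (t @ [l]) \<longleftrightarrow> (\<exists>s' m. s = s' @ [m] \<and> order_iso s' t \<and> (\<forall>x\<in>set s'. x < m))"
proof (cases s rule: rev_cases)
  case Nil
  then show ?thesis by (simp add: order_iso_def)
next
  case (snoc s' m)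
  have "t ! i < l" if "i < length t" for i
    using assms that by simp
  then have "order_iso s (t @ [l]) \<longleftrightarrow> order_iso s' t \<and> (\<forall>i<length t. s' ! i < m)"
    unfolding snoc order_iso_snoc by (meson order.asym)
  also have "\<dots> \<longleftrightarrow> order_iso s' t \<and> (\<forall>x\<in>set s'. x < m)"
    by (simp add: order_iso_def all_set_conv_all_nth cong: conj_cong)
  finally show ?thesis
    using snoc by simp
qed

text \<open>In a decomposition the first letter lies in the upper block and the last letter in the
  lower one. This is the test for indecomposability used for all concrete patterns below.\<close>

lemma not_decreasing_decomposable_if_hd_le_last:
  assumes "hd t \<le> last t"
  shows "\<not> decreasing_decomposable t"
proof
  assume "decreasing_decomposable t"
  then obtain u v where uv: "t = u @ v" "u \<noteq> []" "v \<noteq> []" "\<forall>a\<in>set u. \<forall>b\<in>set v. a > b"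
    unfolding decreasing_decomposable_def by blast
  then have "hd t > last t"
    by (metis hd_append2 hd_in_set last_appendR last_in_set)
  with assms show False by simp
qed

text \<open>If an occurrence took letters from both \<open>u\<close> and \<open>v\<close>, cutting
  \<open>t\<close> at the number of letters taken from \<open>u\<close> would be a decreasing
  decomposition of \<open>t\<close>.\<close>

lemma contains_pattern_skew:
  assumes t: "\<not> decreasing_decomposable t" and uv: "above u v"
  shows "contains_pattern (u @ v) t \<longleftrightarrow> contains_pattern u t \<or> contains_pattern v t"
proof
  assume "contains_pattern (u @ v) t"
  then obtain s where s: "subseq s (u @ v)" "order_iso s t"
    unfolding contains_pattern_iff_subseq by blast
  obtain s1 s2 where s12: "s = s1 @ s2" "subseq s1 u" "subseq s2 v"
    using s(1) by (rule subseq_appendE)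
  have "s1 = [] \<or> s2 = []"
  proof (rule ccontr)
    assume ne: "\<not> (s1 = [] \<or> s2 = [])"
    let ?k = "length s1"
    have len: "length t = length s1 + length s2"
      using s(2) s12(1) by (simp add: order_iso_def)
    have "b < a" if a: "a \<in> set (take ?k t)" and b: "b \<in> set (drop ?k t)" for a b
    proof -
      obtain i where i: "i < ?k" "a = t ! i"
        using a len by (auto simp: in_set_conv_nth)
      obtain j where j: "j < length s2" "b = t ! (?k + j)"
        using b len by (auto simp: in_set_conv_nth)
      have "s1 ! i \<in> set u" "s2 ! j \<in> set v"
        using s12 i j by (meson nth_mem subsetD subseq_imp_set_subset)+
      then have "s ! (?k + j) < s ! i"
        using uv i j s12(1) by (auto simp: above_def nth_append)
      then show ?thesis
        using s(2) i j len by (auto simp: order_iso_def)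
    qed
    then have "decreasing_decomposable t"
      unfolding decreasing_decomposable_def using ne len
      by (intro exI[of _ "take ?k t"] exI[of _ "drop ?k t"]) auto
    with t show False ..
  qed
  then show "contains_pattern u t \<or> contains_pattern v t"
    unfolding contains_pattern_iff_subseq using s s12 by auto
next
  assume "contains_pattern u t \<or> contains_pattern v t"
  then show "contains_pattern (u @ v) t"
    using contains_pattern_subseq[of u "u @ v"] contains_pattern_subseq[of v "u @ v"]
    by (auto intro: subseq_drop_many subseq_rev_drop_many)
qed

section \<open>Appending a maximal letter to a word\<close>

lemma subseq_snocE:
  assumes "subseq s (u @ [m])"
  obtains "subseq s u" | s' where "s = s' @ [m]" "subseq s' u"
proof -
  obtain s1 s2 where s12: "s = s1 @ s2" "subseq s1 u" "subseq s2 [m]"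
    using assms by (rule subseq_appendE)
  have "s2 = [] \<or> s2 = [m]"
    using s12(3) by (cases s2; cases "tl s2") (auto split: if_splits)
  then show ?thesis
    using that s12 by auto
qed

text \<open>All letters of an occurrence except its last one lie in \<open>u\<close>, whichever
  letter plays \<open>l\<close>; conversely \<open>m\<close> can always play
  \<open>l\<close>.\<close>

lemma contains_pattern_snoc_max:
  assumes u: "\<forall>x\<in>set u. x < m" and t: "\<forall>x\<in>set t. x < l"
  shows "contains_pattern (u @ [m]) (t @ [l]) \<longleftrightarrow> contains_pattern u t"
proof
  assume "contains_pattern (u @ [m]) (t @ [l])"
  then obtain r where r: "subseq r (u @ [m])" "order_iso r (t @ [l])"
    unfolding contains_pattern_iff_subseq by blast
  from r(2) obtain s k where "r = s @ [k]" and s_iso: "order_iso s t"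
    using order_iso_snoc_max[OF t, of r] by blast
  with r(1) have s: "subseq (s @ [k]) (u @ [m])" "order_iso s t"
    by simp_all
  from s(1) have "subseq s u"
  proof (cases rule: subseq_snocE)
    case 1
    have "subseq s (s @ [k])"
      by (rule subseq_rev_drop_many) simp
    with 1 show ?thesis
      by (rule subseq_order.trans[rotated])
  qed auto
  with s(2) show "contains_pattern u t"
    unfolding contains_pattern_iff_subseq by blast
next
  assume "contains_pattern u t"
  then obtain s where s: "subseq s u" "order_iso s t"
    unfolding contains_pattern_iff_subseq by blast
  then have "\<forall>x\<in>set s. x < m"
    using u subseq_imp_set_subset by blast
  then have "order_iso (s @ [m]) (t @ [l])"
    using order_iso_snoc_max[OF t, of "s @ [m]"] s(2) by simp
  moreover have "subseq (s @ [m]) (u @ [m])"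
    using s(1) by simp
  ultimately show "contains_pattern (u @ [m]) (t @ [l])"
    unfolding contains_pattern_iff_subseq by blast
qed

text \<open>If an occurrence used \<open>m\<close>, then \<open>m\<close> would be its last and
  largest letter, but the last letter of \<open>t\<close> is exceeded by another one.\<close>

lemma contains_pattern_snoc_not_max:
  assumes u: "\<forall>x\<in>set u. x < m" and t: "\<exists>x\<in>set t. last t < x"
  shows "contains_pattern (u @ [m]) t \<longleftrightarrow> contains_pattern u t"
proof
  assume "contains_pattern (u @ [m]) t"
  then obtain s where s: "subseq s (u @ [m])" "order_iso s t"
    unfolding contains_pattern_iff_subseq by blast
  have len: "length s = length t" and t_ne: "t \<noteq> []"
    using s(2) t by (auto simp: order_iso_def)
  then have s_ne: "s \<noteq> []"
    by auto
  obtain i where i: "i < length t" "last t < t ! i"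
    using t by (auto simp: in_set_conv_nth)
  then have "last s < s ! i"
    using s(2) t_ne s_ne by (simp add: order_iso_def last_conv_nth)
  then have not_max: "\<exists>x\<in>set s. last s < x"
    using i(1) len by (auto intro: bexI[of _ "s ! i"])
  from s(1) have "subseq s u"
  proof (cases rule: subseq_snocE)
    case (2 s')
    then have "\<forall>x\<in>set s'. x < m"
      using u subseq_imp_set_subset[of s' u] by blast
    with not_max 2(1) show ?thesis
      by auto
  qed
  with s(2) show "contains_pattern u t"
    unfolding contains_pattern_iff_subseq by blast
next
  assume "contains_pattern u t"
  then show "contains_pattern (u @ [m]) t"
    by (rule contains_pattern_subseq[rotated]) (rule subseq_rev_drop_many, simp)
qed

text \<open>Occurrences are sorted by whether they use \<open>M\<close>, so that the second kind can
  be analysed through the role \<open>M\<close> plays.\<close>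

lemma contains_pattern_insert:
  "contains_pattern (u @ M # v) t \<longleftrightarrow> contains_pattern (u @ v) t \<or>
     (\<exists>s1 s2. subseq s1 u \<and> subseq s2 v \<and> order_iso (s1 @ M # s2) t)"
proof
  assume "contains_pattern (u @ M # v) t"
  then obtain s where s: "subseq s (u @ M # v)" "order_iso s t"
    unfolding contains_pattern_iff_subseq by blast
  obtain s1 s2 where s12: "s = s1 @ s2" "subseq s1 u" "subseq s2 (M # v)"
    using s(1) by (rule subseq_appendE)
  from s12(3) have "subseq s2 v \<or> (\<exists>s3. s2 = M # s3 \<and> subseq s3 v)"
    by (cases s2) (auto split: if_splits)
  then show "contains_pattern (u @ v) t \<or>
     (\<exists>s1 s2. subseq s1 u \<and> subseq s2 v \<and> order_iso (s1 @ M # s2) t)"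
  proof
    assume "subseq s2 v"
    then have "subseq s (u @ v)"
      unfolding s12(1) by (intro list_emb_append_mono s12(2))
    with s(2) show ?thesis
      unfolding contains_pattern_iff_subseq by blast
  next
    assume "\<exists>s3. s2 = M # s3 \<and> subseq s3 v"
    with s(2) s12(1,2) show ?thesis
      by auto
  qed
next
  assume "contains_pattern (u @ v) t \<or>
     (\<exists>s1 s2. subseq s1 u \<and> subseq s2 v \<and> order_iso (s1 @ M # s2) t)"
  then show "contains_pattern (u @ M # v) t"
  proof
    assume "contains_pattern (u @ v) t"
    then show ?thesis
      by (rule contains_pattern_subseq[rotated]) (simp add: subseq_append' list_emb_Cons)
  next
    assume "\<exists>s1 s2. subseq s1 u \<and> subseq s2 v \<and> order_iso (s1 @ M # s2) t"
    then obtain s1 s2 where "subseq s1 u" "subseq s2 v" "order_iso (s1 @ M # s2) t"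
      by blast
    moreover from this have "subseq (s1 @ M # s2) (u @ M # v)"
      by (simp add: list_emb_append_mono)
    ultimately show ?thesis
      unfolding contains_pattern_iff_subseq by blast
  qed
qed

lemma contains_pattern_butlast:
  "contains_pattern w (t @ [l]) \<Longrightarrow> contains_pattern w t"
proof -
  assume "contains_pattern w (t @ [l])"
  then obtain s where s: "subseq s w" "order_iso s (t @ [l])"
    unfolding contains_pattern_iff_subseq by blast
  then have "s \<noteq> []"
    by (auto simp: order_iso_def)
  then obtain r k where r: "s = r @ [k]"
    using rev_exhaust by blast
  have "subseq r s"
    unfolding r by (rule subseq_rev_drop_many) simp
  moreover have "order_iso r t"
    using s(2) unfolding r order_iso_snoc by blast
  ultimately show "contains_pattern w t"
    using s(1) subseq_order.trans unfolding contains_pattern_iff_subseq by blast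
qed

text \<open>The last letter of the occurrence exceeds all others, hence exceeds \<open>M\<close>
  unless it is \<open>M\<close> itself; no letter of \<open>s2\<close> is large enough.\<close>

lemma order_iso_max_last:
  assumes iso: "order_iso (s1 @ M # s2) (t @ [l])"
    and "\<forall>x\<in>set s2. x < M" "\<forall>x\<in>set t. x < l"
  shows "s2 = [] \<and> order_iso s1 t"
proof -
  obtain r k where r: "s1 @ M # s2 = r @ [k]" "order_iso r t" "\<forall>x\<in>set r. x < k"
    using iso order_iso_snoc_max[OF assms(3)] by blast
  show ?thesis
  proof (cases s2 rule: rev_cases)
    case Nil
    with r show ?thesis by simp
  next
    case (snoc s3 y)
    with r(1) have "r = s1 @ M # s3" "k = y"
      by simp_all
    with r(3) assms(2) snoc show ?thesis
      by auto
  qed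
qed

lemma order_iso_1342:
  "order_iso s [1, 3, 4, 2] \<longleftrightarrow> (\<exists>a b c d. s = [a, b, c, d] \<and> a < d \<and> d < b \<and> b < c)"
proof (cases "length s = 4")
  case True
  then obtain a b c d where "s = [a, b, c, d]"
    by (auto simp: numeral_eq_Suc length_Suc_conv)
  then show ?thesis
    by (auto simp: order_iso_def All_less_Suc numeral_eq_Suc)
qed (auto simp: order_iso_def)

lemma order_iso_1423:
  "order_iso s [1, 4, 2, 3] \<longleftrightarrow> (\<exists>a b c d. s = [a, b, c, d] \<and> a < c \<and> c < d \<and> d < b)"
proof (cases "length s = 4")
  case True
  then obtain a b c d where "s = [a, b, c, d]"
    by (auto simp: numeral_eq_Suc length_Suc_conv)
  then show ?thesis
    by (auto simp: order_iso_def All_less_Suc numeral_eq_Suc)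
qed (auto simp: order_iso_def)

section \<open>Patterns in \<open>u @ M # v @ [m]\<close>, where \<open>u\<close> is above
  \<open>v\<close> and \<open>m < M\<close> are the largest letters\<close>

lemma above_imp_not_less: "above u v \<Longrightarrow> x \<in> set u \<Longrightarrow> y \<in> set v \<Longrightarrow> \<not> x < y"
  by (auto simp: above_def dest: order.asym)

context
  fixes u v :: "nat list" and m M :: nat
  assumes uv: "above u v" and bound: "\<forall>x\<in>set u \<union> set v. x < m" and mM: "m < M"
begin

text \<open>An occurrence that uses \<open>M\<close> must end there, so \<open>t\<close> is already
  found in \<open>u\<close>. For the others, \<open>m\<close> can play \<open>l\<close>, and what
  remains is an occurrence of the indecomposable \<open>t\<close> in \<open>u @ v\<close>.\<close>

lemma contains_pattern_insert_max_last:
  assumes t: "\<not> decreasing_decomposable t" "\<forall>x\<in>set t. x < l"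
  shows "contains_pattern (u @ M # v @ [m]) (t @ [l]) \<longleftrightarrow> contains_pattern u t \<or> contains_pattern v t"
proof -
  have *: "contains_pattern (u @ v @ [m]) (t @ [l]) \<longleftrightarrow> contains_pattern u t \<or> contains_pattern v t"
    using contains_pattern_snoc_max[of "u @ v" m t l] contains_pattern_skew[OF t(1) uv] bound t(2)
    by auto
  have "contains_pattern u t"
    if "subseq s1 u" "subseq s2 (v @ [m])" "order_iso (s1 @ M # s2) (t @ [l])" for s1 s2
  proof -
    have "\<forall>x\<in>set (v @ [m]). x < M"
      using bound mM by (auto intro: order.strict_trans)
    then have "\<forall>x\<in>set s2. x < M"
      using subseq_imp_set_subset[OF that(2)] by blast
    then have "order_iso s1 t"
      using order_iso_max_last that(3) t(2) by blast
    with that(1) show ?thesis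
      unfolding contains_pattern_iff_subseq by blast
  qed
  with * show ?thesis
    unfolding contains_pattern_insert by blast
qed

text \<open>In an occurrence that uses \<open>M\<close>, this letter can be followed only by the one
  playing \<open>l'\<close>, so \<open>M\<close> plays \<open>l\<close> and \<open>t\<close> occurs
  in \<open>u\<close>. An occurrence without \<open>M\<close> cannot use \<open>m\<close> either,
  since its last letter is not its largest.\<close>

lemma contains_pattern_insert_max_penultimate:
  assumes t: "\<forall>x\<in>set t. x < l'" "l' < l"
  shows "contains_pattern (u @ M # v @ [m]) (t @ [l, l']) \<longleftrightarrow>
    contains_pattern u t \<or> contains_pattern v (t @ [l, l'])"
proof
  assume *: "contains_pattern (u @ M # v @ [m]) (t @ [l, l'])"
  show "contains_pattern u t \<or> contains_pattern v (t @ [l, l'])"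
  \<comment> \<open>For empty \<open>t\<close> the pattern is a descent and is decomposable, but
    then the first disjunct holds trivially because the empty pattern occurs in
    \<open>u\<close>.\<close>
  proof (cases "t = []")
    case False
    from * consider "contains_pattern ((u @ v) @ [m]) (t @ [l, l'])"
      | s1 s2 where "subseq s1 u" "subseq s2 (v @ [m])" "order_iso (s1 @ M # s2) (t @ [l, l'])"
      unfolding contains_pattern_insert append_assoc by blast
    then show ?thesis
    proof cases
      case 1
      then have "contains_pattern (u @ v) (t @ [l, l'])"
        using contains_pattern_snoc_not_max[of "u @ v" m "t @ [l, l']"] bound t(2) by auto
      moreover have "hd t < l'"
        using t(1) False by simp
      then have "\<not> decreasing_decomposable (t @ [l, l'])"
        using False by (intro not_decreasing_decomposable_if_hd_le_last) simp
      ultimately show ?thesis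
        using contains_pattern_skew[OF _ uv, of "t @ [l, l']"]
          contains_pattern_butlast[of u "t @ [l]" l'] contains_pattern_butlast[of u t l] by auto
    next
      case 2
      have "\<forall>x\<in>set u \<union> set (v @ [m]). x < M"
        using bound mM by (auto intro: order.strict_trans)
      then have s1: "\<forall>x\<in>set s1. x < M" and s2: "\<forall>x\<in>set s2. x < M"
        using subseq_imp_set_subset[OF 2(1)] subseq_imp_set_subset[OF 2(2)] by blast+
      have iso: "order_iso (s1 @ M # s2) ((t @ [l]) @ [l'])"
        using 2(3) by simp
      show ?thesis
      proof (cases s2 rule: rev_cases)
        case Nil
        then have "order_iso (s1 @ [M]) ((t @ [l]) @ [l'])"
          using iso by simp
        \<comment> \<open>Here \<open>M\<close> would play \<open>l'\<close> and the last letter of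
          \<open>s1\<close> would play \<open>l\<close>, although \<open>M\<close> exceeds all of
          \<open>s1\<close>.\<close>
        then have "length s1 = Suc (length t)" "M < s1 ! length t"
          unfolding order_iso_snoc using t(2) by (auto simp: order_iso_def)
        then show ?thesis
          using s1 by (metis lessI nth_mem order.asym)
      next
        case (snoc s3 y)
        then have "order_iso ((s1 @ M # s3) @ [y]) ((t @ [l]) @ [l'])"
          using iso by simp
        then have "order_iso (s1 @ M # s3) (t @ [l])"
          unfolding order_iso_snoc by blast
        moreover have "\<forall>x\<in>set s3. x < M"
          using s2 snoc by simp
        moreover have "\<forall>x\<in>set t. x < l"
          using t by auto
        ultimately have "order_iso s1 t"
          using order_iso_max_last by blast
        with 2(1) show ?thesis
          unfolding contains_pattern_iff_subseq by blast
      qed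
    qed
  qed simp
next
  assume "contains_pattern u t \<or> contains_pattern v (t @ [l, l'])"
  then show "contains_pattern (u @ M # v @ [m]) (t @ [l, l'])"
  proof
    assume "contains_pattern u t"
    then obtain s where s: "subseq s u" "order_iso s t"
      unfolding contains_pattern_iff_subseq by blast
    have len: "length s = length t"
      using s(2) by (simp add: order_iso_def)
    have sm: "s ! i < m" if "i < length t" for i
      using subseq_imp_set_subset[OF s(1)] bound that len by (metis UnI1 nth_mem subsetD)
    have tl: "t ! i < l'" if "i < length t" for i
      using t(1) that by simp
    \<comment> \<open>Conversely, an occurrence of \<open>t\<close> in \<open>u\<close> is completed
      by \<open>M\<close> as \<open>l\<close> and by the final \<open>m\<close> as
      \<open>l'\<close>; both exceed every letter of \<open>u\<close>.\<close>
    have "order_iso (s @ [M]) (t @ [l])"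
      unfolding order_iso_snoc using s(2) sm tl mM t(2) by (meson order.strict_trans order.asym)
    then have "order_iso ((s @ [M]) @ [m]) ((t @ [l]) @ [l'])"
      unfolding order_iso_snoc[of "s @ [M]"] using sm tl mM t(2) len
      by (auto simp: nth_append less_Suc_eq dest: order.asym)
    then have "order_iso (s @ M # [m]) (t @ [l, l'])"
      by simp
    moreover have "subseq [m] (v @ [m])"
      by (simp add: subseq_singleton_left)
    ultimately show ?thesis
      unfolding contains_pattern_insert using s(1) by blast
  next
    assume "contains_pattern v (t @ [l, l'])"
    then show ?thesis
      by (rule contains_pattern_subseq[rotated])
        (metis append_Cons append_assoc subseq_drop_many subseq_order.order_refl subseq_rev_drop_many append_Nil)
  qed
qed

text \<open>As the largest letter, \<open>M\<close> can only play 4. Then 1 and 3 come from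
  \<open>u\<close>, and 2, being below 3 and hence below \<open>m\<close>, comes from
  \<open>v\<close>; this contradicts that \<open>u\<close> is above \<open>v\<close>.\<close>

lemma contains_1342_insert:
  "contains_pattern (u @ M # v @ [m]) [1, 3, 4, 2] \<longleftrightarrow>
    contains_pattern u [1, 3, 4, 2] \<or> contains_pattern v [1, 3, 4, 2]"
proof -
  have "\<not> decreasing_decomposable [1, 3, 4, 2]"
    by (rule not_decreasing_decomposable_if_hd_le_last) simp
  then have *: "contains_pattern (u @ v @ [m]) [1, 3, 4, 2] \<longleftrightarrow>
      contains_pattern u [1, 3, 4, 2] \<or> contains_pattern v [1, 3, 4, 2]"
    using contains_pattern_snoc_not_max[of "u @ v" m "[1, 3, 4, 2]"]
      contains_pattern_skew[OF _ uv] bound by auto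
  have False
    if sub: "subseq s1 u" "subseq s2 (v @ [m])" and iso: "order_iso (s1 @ M # s2) [1, 3, 4, 2]" for s1 s2
  proof -
    obtain a b c d where abcd: "s1 @ M # s2 = [a, b, c, d]" "a < d" "d < b" "b < c"
      using iso unfolding order_iso_1342 by blast
    have lt: "\<forall>x\<in>set s1. x < m" "\<forall>x\<in>set s2. x \<le> m" "set s2 \<subseteq> insert m (set v)" "set s1 \<subseteq> set u"
      using subseq_imp_set_subset[OF sub(1)] subseq_imp_set_subset[OF sub(2)] bound
      by (auto intro: less_imp_le)
    have "M = c"
      using abcd lt mM by (auto simp: append_eq_Cons_conv)
    then have "s1 = [a, b]" "s2 = [d]"
      using abcd lt mM by (auto simp: append_eq_Cons_conv)
    then show False
      using lt abcd above_imp_not_less[OF uv, of a d] by auto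
  qed
  with * show ?thesis
    unfolding contains_pattern_insert by blast
qed

text \<open>Again \<open>M\<close> plays 4, so 1 comes from \<open>u\<close>. The letter playing 2
  is smaller than the one playing 3, so it is not \<open>m\<close> and comes from \<open>v\<close>,
  against \<open>above u v\<close>.\<close>

lemma contains_1423_insert:
  "contains_pattern (u @ M # v @ [m]) [1, 4, 2, 3] \<longleftrightarrow>
    contains_pattern u [1, 4, 2, 3] \<or> contains_pattern v [1, 4, 2, 3]"
proof -
  have "\<not> decreasing_decomposable [1, 4, 2, 3]"
    by (rule not_decreasing_decomposable_if_hd_le_last) simp
  then have *: "contains_pattern (u @ v @ [m]) [1, 4, 2, 3] \<longleftrightarrow>
      contains_pattern u [1, 4, 2, 3] \<or> contains_pattern v [1, 4, 2, 3]"
    using contains_pattern_snoc_not_max[of "u @ v" m "[1, 4, 2, 3]"]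
      contains_pattern_skew[OF _ uv] bound by auto
  have False
    if sub: "subseq s1 u" "subseq s2 (v @ [m])" and iso: "order_iso (s1 @ M # s2) [1, 4, 2, 3]" for s1 s2
  proof -
    obtain a b c d where abcd: "s1 @ M # s2 = [a, b, c, d]" "a < c" "c < d" "d < b"
      using iso unfolding order_iso_1423 by blast
    have lt: "\<forall>x\<in>set s1. x < m" "\<forall>x\<in>set s2. x \<le> m" "set s2 \<subseteq> insert m (set v)" "set s1 \<subseteq> set u"
      using subseq_imp_set_subset[OF sub(1)] subseq_imp_set_subset[OF sub(2)] bound
      by (auto intro: less_imp_le)
    have "M = b"
      using abcd lt mM by (auto simp: append_eq_Cons_conv)
    then have "s1 = [a]" "s2 = [c, d]"
      using abcd lt mM by (auto simp: append_eq_Cons_conv)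
    then show False
      using lt abcd above_imp_not_less[OF uv, of a c] by auto
  qed
  with * show ?thesis
    unfolding contains_pattern_insert by blast
qed

end

section \<open>Decomposition of Dumont permutations\<close>

definition dumont_step :: "nat \<Rightarrow> nat \<Rightarrow> bool" where
  "dumont_step a b \<longleftrightarrow> (if even a then b < a else a < b)"

text \<open>Formulated for words over arbitrary letters, so that it applies to factors and shifts of
  permutations. An even last letter would lack its smaller successor, hence the parity
  condition.\<close>

definition dumont_word :: "nat list \<Rightarrow> bool" where
  "dumont_word w \<longleftrightarrow> successively dumont_step w \<and> (w \<noteq> [] \<longrightarrow> odd (last w))"

lemma perms_iff: "w \<in> perms N \<longleftrightarrow> set w = {1..N} \<and> distinct w"
  by (auto simp: perms_def permutations_of_set_def)

lemma length_perms: "w \<in> perms N \<Longrightarrow> length w = N"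
  by (metis perms_iff distinct_card card_atLeastAtMost diff_Suc_1)

lemma successively_conv_nth:
  "successively P w \<longleftrightarrow> (\<forall>i. Suc i < length w \<longrightarrow> P (w ! i) (w ! Suc i))"
proof (induction w)
  case (Cons x w)
  show ?case
    unfolding successively_Cons Cons
    by (cases w) (auto simp: nth_Cons hd_conv_nth split: nat.splits)
qed simp

lemma dumont1_iff: "w \<in> dumont1 n \<longleftrightarrow> w \<in> perms (2 * n) \<and> dumont_word w"
proof (cases "w \<in> perms (2 * n)")
  case True
  then have len: "length w = 2 * n"
    by (rule length_perms)
  have "(\<forall>i<2 * n. (even (w ! i) \<longrightarrow> Suc i < 2 * n \<and> w ! i > w ! Suc i) \<and>
      (odd (w ! i) \<longrightarrow> Suc i = 2 * n \<or> w ! i < w ! Suc i)) \<longleftrightarrow>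
    (\<forall>i. Suc i < 2 * n \<longrightarrow> dumont_step (w ! i) (w ! Suc i)) \<and> (\<forall>i. Suc i = 2 * n \<longrightarrow> odd (w ! i))"
    (is "?L \<longleftrightarrow> ?R")
  proof
    assume L: ?L
    show ?R
    proof (intro conjI allI impI)
      fix i assume "Suc i < 2 * n"
      with L[rule_format, of i] show "dumont_step (w ! i) (w ! Suc i)"
        by (auto simp: dumont_step_def)
    next
      fix i assume "Suc i = 2 * n"
      with L[rule_format, of i] show "odd (w ! i)"
        by auto
    qed
  next
    assume R: ?R
    show ?L
    proof (intro allI impI)
      fix i assume "i < 2 * n"
      then have "Suc i < 2 * n \<or> Suc i = 2 * n" by auto
      with R show "(even (w ! i) \<longrightarrow> Suc i < 2 * n \<and> w ! i > w ! Suc i) \<and>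
          (odd (w ! i) \<longrightarrow> Suc i = 2 * n \<or> w ! i < w ! Suc i)"
        unfolding dumont_step_def by (metis)
    qed
  qed
  also have "(\<forall>i. Suc i = 2 * n \<longrightarrow> odd (w ! i)) \<longleftrightarrow> (w \<noteq> [] \<longrightarrow> odd (last w))"
    using len by (cases n) (auto simp: last_conv_nth)
  finally show ?thesis
    using True len by (simp add: dumont1_def dumont_word_def successively_conv_nth)
qed (simp add: dumont1_def)

section \<open>Joining two Dumont permutations by two new largest letters\<close>

lemma dumont_word_map_add:
  assumes "even k"
  shows "dumont_word (map ((+) k) w) \<longleftrightarrow> dumont_word w"
  using assms by (simp add: dumont_word_def successively_map dumont_step_def last_map cong: if_cong)

text \<open>Shifting \<open>u\<close> by the length of \<open>v\<close> puts its letters directly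
  above those of \<open>v\<close>. Here the largest odd letter comes last; in \<open>join2\<close>
  it directly precedes the maximum.\<close>

definition join1 :: "nat list \<Rightarrow> nat list \<Rightarrow> nat list" where
  "join1 u v = map ((+) (length v)) u @ (length u + length v + 2) # v @ [length u + length v + 1]"

definition join2 :: "nat list \<Rightarrow> nat list \<Rightarrow> nat list" where
  "join2 u v = (map ((+) (length v)) u @ [length u + length v + 1] @ [length u + length v + 2]) @ v"

lemma length_join1 [simp]: "length (join1 u v) = length u + length v + 2"
  by (simp add: join1_def)

lemma length_join2 [simp]: "length (join2 u v) = length u + length v + 2"
  by (simp add: join2_def)

lemma set_map_add_perms: "u \<in> perms i \<Longrightarrow> set (map ((+) j) u) = {j + 1..j + i}"
  by (simp add: perms_iff)

lemma joins_in_perms: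
  assumes "u \<in> perms i" "v \<in> perms j"
  shows "join1 u v \<in> perms (i + j + 2)" and "join2 u v \<in> perms (i + j + 2)"
proof -
  have v: "set v = {1..j}" "distinct v"
    using assms(2) by (auto simp: perms_iff)
  have u: "set (map ((+) j) u) = {j + 1..j + i}" "distinct (map ((+) j) u)"
    using assms(1) set_map_add_perms by (auto simp: perms_iff distinct_map)
  note len = length_perms[OF assms(1)] length_perms[OF assms(2)]
  show "join1 u v \<in> perms (i + j + 2)" "join2 u v \<in> perms (i + j + 2)"
    using u v unfolding join1_def join2_def perms_iff len set_append list.set distinct_append
    by (auto simp del: set_map)
qed

text \<open>Every junction is a permitted step: the odd last letters of \<open>U\<close> and
  \<open>v\<close> are followed by larger letters, the even maximum by a smaller one, and the final
  \<open>i + j + 1\<close> is odd.\<close>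

lemma dumont_word_join1:
  assumes "u \<in> perms i" "v \<in> perms j" "even i" "even j" "dumont_word u" "dumont_word v"
  shows "dumont_word (join1 u v)"
proof -
  define U where "U = map ((+) j) u"
  note len = length_perms[OF assms(1)] length_perms[OF assms(2)]
  have U: "dumont_word U" "set U = {j + 1..j + i}"
    unfolding U_def using assms by (simp_all only: dumont_word_map_add set_map_add_perms)
  have lastU: "last U < i + j + 2" if "U \<noteq> []"
    using last_in_set[OF that] U(2) by simp
  have hdv: "hd v < i + j + 2" "last v < i + j + 1" if "v \<noteq> []"
    using last_in_set[OF that] hd_in_set[OF that] assms(2) by (auto simp: perms_iff)
  have "dumont_word (U @ (i + j + 2) # v @ [i + j + 1])"
    using U(1) assms(3,4,6) lastU hdv
    by (auto simp: dumont_word_def successively_append_iff successively_Cons dumont_step_def hd_append)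
  then show ?thesis
    unfolding join1_def len U_def by simp
qed

text \<open>The nonempty \<open>v\<close> supplies both the smaller successor of the even maximum
  and an odd last letter.\<close>

lemma dumont_word_join2:
  assumes "u \<in> perms i" "v \<in> perms j" "even i" "even j" "dumont_word u" "dumont_word v" "v \<noteq> []"
  shows "dumont_word (join2 u v)"
proof -
  define U where "U = map ((+) j) u"
  note len = length_perms[OF assms(1)] length_perms[OF assms(2)]
  have U: "dumont_word U" "set U = {j + 1..j + i}"
    unfolding U_def using assms by (simp_all only: dumont_word_map_add set_map_add_perms)
  have lastU: "last U < i + j + 1" if "U \<noteq> []"
    using last_in_set[OF that] U(2) by simp
  have hdv: "hd v < i + j + 2"
    using hd_in_set[OF assms(7)] assms(2) by (auto simp: perms_iff)
  have "dumont_word ((U @ [i + j + 1] @ [i + j + 2]) @ v)"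
    using U(1) assms(3,4,6,7) lastU hdv
    by (auto simp: dumont_word_def successively_append_iff successively_Cons dumont_step_def hd_append)
  then show ?thesis
    unfolding join2_def len U_def by simp
qed

lemma joins_in_dumont1:
  assumes "u \<in> dumont1 i" "v \<in> dumont1 j"
  shows "join1 u v \<in> dumont1 (Suc (i + j))" and "v \<noteq> [] \<Longrightarrow> join2 u v \<in> dumont1 (Suc (i + j))"
proof -
  have "2 * i + 2 * j + 2 = 2 * Suc (i + j)" by simp
  then show "join1 u v \<in> dumont1 (Suc (i + j))" "v \<noteq> [] \<Longrightarrow> join2 u v \<in> dumont1 (Suc (i + j))"
    using assms joins_in_perms[of u "2 * i" v "2 * j"] dumont_word_join1[of u "2 * i" v "2 * j"]
      dumont_word_join2[of u "2 * i" v "2 * j"]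
    unfolding dumont1_iff by simp_all
qed

section \<open>Recovering the two blocks of a Dumont permutation\<close>

lemma split_interval:
  fixes A B :: "nat set"
  assumes un: "A \<union> B = {1..N}" and gt: "\<forall>a\<in>A. \<forall>b\<in>B. b < a"
  shows "B = {1..card B} \<and> A = {card B + 1..N}"
proof -
  have fin: "finite B"
    using un by (metis finite_Un finite_atLeastAtMost)
  \<comment> \<open>The value 0 for empty \<open>B\<close> makes \<open>{1..m}\<close> empty too.
    Otherwise \<open>B\<close> is closed downwards in \<open>{1..N}\<close>, since a missing letter
    below \<open>m\<close> would belong to \<open>A\<close>.\<close>
  define m where "m = (if B = {} then 0 else Max B)"
  have "B = {1..m}"
  proof (cases "B = {}")
    case False
    then have "m \<in> B" and le: "\<forall>b\<in>B. b \<le> m"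
      using fin by (auto simp: m_def)
    have "x \<in> B" if "x \<in> {1..m}" for x
    proof (rule ccontr)
      assume "x \<notin> B"
      moreover have "m \<in> {1..N}"
        using un \<open>m \<in> B\<close> by blast
      then have "x \<in> A \<union> B"
        unfolding un using that by simp
      ultimately have "x \<in> A"
        by blast
      with gt \<open>m \<in> B\<close> that show False by force
    qed
    with le un show ?thesis by fastforce
  qed (simp add: m_def)
  then have B: "B = {1..card B}"
    by simp
  have "A \<inter> B = {}"
    using gt by fastforce
  then have "A = {1..N} - {1..card B}"
    using un B by blast
  then have "A = {card B + 1..N}"
    by auto
  with B show ?thesis
    by simp
qed

text \<open>The point is that \<open>y\<close> has even length: otherwise the smallest letter of
  \<open>x\<close> would be even and would need a smaller successor inside \<open>x\<close>. Then
  \<open>x\<close> can be shifted down without changing parities.\<close>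

lemma dumont_word_skew:
  assumes x: "dumont_word x" "distinct x" and xy: "set x \<union> set y = {1..2 * n}" "above x y" "distinct y"
  obtains i u where "i \<le> n" "u \<in> dumont1 i" "x = map ((+) (length y)) u" "y \<in> perms (2 * (n - i))"
proof -
  define m where "m = length y"
  have "card (set y) = m"
    using xy(3) by (simp add: m_def distinct_card)
  then have sety: "set y = {1..m}" and setx: "set x = {m + 1..2 * n}"
    using split_interval[OF xy(1)] xy(2) by (auto simp: above_def)
  have "m \<le> 2 * n"
    using xy(1) sety by (cases "m = 0") auto
  have "even m"
  proof (rule ccontr)
    assume "odd m"
    then have "m < 2 * n"
      using \<open>m \<le> 2 * n\<close> by (cases "m = 2 * n") auto
    then have "m + 1 \<in> set x"
      using setx by simp
    then obtain a b where ab: "x = a @ (m + 1) # b"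
      by (meson split_list)
    show False
    proof (cases b)
      case Nil
      with x(1) ab \<open>odd m\<close> show ?thesis
        by (simp add: dumont_word_def)
    next
      case (Cons c b')
      then have "dumont_step (m + 1) c"
        using x(1) ab by (simp add: dumont_word_def successively_append_iff successively_Cons)
      moreover have "c \<in> set x"
        using ab Cons by simp
      then have "m + 1 \<le> c"
        unfolding setx by simp
      ultimately show ?thesis
        using \<open>odd m\<close> by (simp add: dumont_step_def)
    qed
  qed
  then obtain j where j: "m = 2 * j"
    by blast
  have "j \<le> n"
    using \<open>m \<le> 2 * n\<close> j by simp
  define u where "u = map (\<lambda>a. a - m) x"
  have xu: "x = map ((+) m) u"
    unfolding u_def map_map by (rule map_idI[symmetric]) (use setx in auto)
  have "set u = {1..2 * n - m}"
    unfolding u_def set_map setx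
  proof (intro equalityI subsetI)
    fix a assume "a \<in> {1..2 * n - m}"
    then show "a \<in> (\<lambda>a. a - m) ` {m + 1..2 * n}"
      by (intro image_eqI[of _ _ "a + m"]) auto
  qed auto
  moreover have "distinct u"
    using x(2) xu by (simp add: distinct_map)
  moreover have "2 * n - m = 2 * (n - j)"
    using j by simp
  moreover have "dumont_word u"
    using x(1) \<open>even m\<close> xu dumont_word_map_add by simp
  ultimately have "u \<in> dumont1 (n - j)"
    by (simp add: dumont1_iff perms_iff)
  moreover have "y \<in> perms (2 * (n - (n - j)))"
    using sety xy(3) j \<open>j \<le> n\<close> by (simp add: perms_iff)
  ultimately show ?thesis
    using that[of "n - j" u] xu by (simp add: m_def)
qed

text \<open>The maximum is a separate variable \<open>M\<close>, so that the rule also fits when it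
  is written as \<open>2 * n + 2\<close>.\<close>

lemma set_split_perms:
  assumes "p @ M # q \<in> perms (Suc N)" "M = Suc N"
  shows "set p \<union> set q = {1..N}" "distinct p" "distinct q" "set p \<inter> set q = {}"
proof -
  have d: "distinct (p @ M # q)" and s: "insert M (set p \<union> set q) = {1..Suc N}"
    using assms(1) by (auto simp: perms_iff)
  have "M \<notin> set p \<union> set q"
    using d by auto
  then have "set p \<union> set q = {1..Suc N} - {M}"
    using s by blast
  also have "\<dots> = {1..N}"
    using assms(2) by auto
  finally show "set p \<union> set q = {1..N}" "distinct p" "distinct q" "set p \<inter> set q = {}"
    using d by auto
qed

lemma dumont1_SucE:
  assumes w: "w \<in> dumont1 (Suc n)"
    and av: "avoids_pattern w [1, 3, 4, 2]" "avoids_pattern w [1, 4, 2, 3]"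
  obtains i u v where "i \<le> n" "u \<in> dumont1 i" "v \<in> dumont1 (n - i)" "w = join1 u v"
  | i u v where "i \<le> n" "u \<in> dumont1 i" "v \<in> dumont1 (n - i)" "v \<noteq> []" "w = join2 u v"
proof -
  have no1342: "\<not> (a < d \<and> d < b \<and> b < c)" if "subseq [a, b, c, d] w" for a b c d
    using av(1) that unfolding avoids_pattern_def contains_pattern_iff_subseq order_iso_1342 by blast
  have no1423: "\<not> (a < c \<and> c < d \<and> d < b)" if "subseq [a, b, c, d] w" for a b c d
    using av(2) that unfolding avoids_pattern_def contains_pattern_iff_subseq order_iso_1423 by blast
  have wp: "w \<in> perms (Suc (Suc (2 * n)))" and wd: "dumont_word w"
    using w by (simp_all add: dumont1_iff)
  then have "2 * n + 2 \<in> set w"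
    by (simp add: perms_iff)
  then obtain x y where xy: "w = x @ (2 * n + 2) # y"
    by (meson split_list)
  have xy_set: "set x \<union> set y = {1..2 * n + 1}" "distinct x" "distinct y" "set x \<inter> set y = {}"
    using set_split_perms[of x "2 * n + 2" y "Suc (2 * n)"] wp xy by simp_all
  have y_ne: "y \<noteq> []"
    using wd xy by (auto simp: dumont_word_def)
  have "2 * n + 1 \<in> set x \<union> set y"
    unfolding xy_set(1) by simp
  then have "2 * n + 1 \<in> set x \<or> 2 * n + 1 \<in> set y"
    by simp
  then show ?thesis
  proof
    assume "2 * n + 1 \<in> set y"
    then obtain v z where v: "y = v @ (2 * n + 1) # z"
      by (meson split_list)
    \<comment> \<open>The odd letter \<open>2 * n + 1\<close> would need a larger successor, and the
      only larger letter stands to its left.\<close>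
    have "z = []"
    proof (cases z)
      case (Cons c z')
      then have "dumont_step (2 * n + 1) c"
        using wd xy v by (simp add: dumont_word_def successively_append_iff successively_Cons)
      moreover have "c \<le> 2 * n + 1"
        using xy_set(1) v Cons by auto
      ultimately show ?thesis
        by (simp add: dumont_step_def)
    qed
    have "x @ (2 * n + 1) # v \<in> perms (Suc (2 * n))"
      using xy_set v \<open>z = []\<close> by (auto simp: perms_iff)
    then have xv: "set x \<union> set v = {1..2 * n}" "distinct x" "distinct v"
      using set_split_perms[of x "2 * n + 1" v "2 * n"] by simp_all
    have le: "a \<le> 2 * n" if "a \<in> set x \<union> set v" for a
      using that unfolding xv(1) by simp
    \<comment> \<open>The ascent from the last letter of \<open>x\<close> to
      \<open>2 * n + 2\<close> shows that this letter is odd; the same reasoning recurs for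
      \<open>v\<close> and for \<open>x'\<close>.\<close>
    have dx: "dumont_word x"
    proof -
      have "last x < 2 * n + 2" if "x \<noteq> []"
        using last_in_set[OF that] le[of "last x"] by simp
      then show ?thesis
        using wd xy by (cases "x = []") (auto simp: dumont_word_def successively_append_iff dumont_step_def split: if_splits)
    qed
    have dv: "dumont_word v"
    proof -
      have "last v < 2 * n + 1" if "v \<noteq> []"
        using last_in_set[OF that] le[of "last v"] by simp
      then show ?thesis
        using wd xy v by (cases "v = []") (auto simp: dumont_word_def successively_append_iff successively_Cons dumont_step_def split: if_splits)
    qed
    have "above x v"
      unfolding above_def
    proof (intro ballI, rule ccontr)
      fix a b assume ab: "a \<in> set x" "b \<in> set v" "\<not> b < a"
      \<comment> \<open>With \<open>a < b\<close> these four letters would form 1423.\<close>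
      have "subseq ([a] @ (2 * n + 2) # [b] @ [2 * n + 1]) w"
        unfolding xy v \<open>z = []\<close> using ab(1,2)
        by (intro list_emb_append_mono subseq_Cons2) (simp_all add: subseq_singleton_left)
      then have "\<not> (a < b \<and> b < 2 * n + 1 \<and> 2 * n + 1 < 2 * n + 2)"
        by (intro no1423) simp
      moreover have "b < 2 * n + 1" "a \<noteq> b"
        using ab le[of b] xy_set(4) v by auto
      ultimately show False
        using ab(3) by auto
    qed
    then obtain i u where u: "i \<le> n" "u \<in> dumont1 i" "x = map ((+) (length v)) u" "v \<in> perms (2 * (n - i))"
      using dumont_word_skew[OF dx xv(2,1) _ xv(3)] by blast
    have "length u + length v = 2 * n"
      using u(1,2) length_perms[of u "2 * i"] length_perms[OF u(4)] by (simp add: dumont1_iff)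
    then have "w = join1 u v"
      unfolding xy v \<open>z = []\<close> join1_def u(3) by simp
    then show ?thesis
      using that(1)[of i u v] u(1,2,4) dv by (simp add: dumont1_iff)
  next
    assume "2 * n + 1 \<in> set x"
    then obtain x' z where x': "x = x' @ (2 * n + 1) # z"
      by (meson split_list)
    \<comment> \<open>A letter between \<open>2 * n + 1\<close> and \<open>2 * n + 2\<close> would
      be a smaller successor of an odd letter, so the two are adjacent.\<close>
    have "z = []"
    proof (cases z)
      case (Cons c z')
      then have "dumont_step (2 * n + 1) c"
        using wd xy x' by (simp add: dumont_word_def successively_append_iff successively_Cons)
      moreover have "c \<le> 2 * n + 1"
        using xy_set(1) x' Cons by auto
      ultimately show ?thesis
        by (simp add: dumont_step_def)
    qed
    have "x' @ (2 * n + 1) # y \<in> perms (Suc (2 * n))"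
      using xy_set x' \<open>z = []\<close> by (auto simp: perms_iff)
    then have xv: "set x' \<union> set y = {1..2 * n}" "distinct x'" "distinct y"
      using set_split_perms[of x' "2 * n + 1" y "2 * n"] by simp_all
    have le: "a \<le> 2 * n" if "a \<in> set x' \<union> set y" for a
      using that unfolding xv(1) by simp
    have dx: "dumont_word x'"
    proof -
      have "last x' < 2 * n + 1" if "x' \<noteq> []"
        using last_in_set[OF that] le[of "last x'"] by simp
      then show ?thesis
        using wd xy x' by (cases "x' = []") (auto simp: dumont_word_def successively_append_iff dumont_step_def split: if_splits)
    qed
    have dv: "dumont_word y"
      using wd xy y_ne by (auto simp: dumont_word_def successively_append_iff successively_Cons)
    have "above x' y"
      unfolding above_def
    proof (intro ballI, rule ccontr)
      fix a b assume ab: "a \<in> set x'" "b \<in> set y" "\<not> b < a"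
      \<comment> \<open>With \<open>a < b\<close> these four letters would form 1342.\<close>
      have "subseq (([a] @ [2 * n + 1]) @ (2 * n + 2) # [b]) w"
        unfolding xy x' \<open>z = []\<close> using ab(1,2)
        by (intro list_emb_append_mono subseq_Cons2) (simp_all add: subseq_singleton_left)
      then have "\<not> (a < b \<and> b < 2 * n + 1 \<and> 2 * n + 1 < 2 * n + 2)"
        by (intro no1342) simp
      moreover have "b < 2 * n + 1" "a \<noteq> b"
        using ab le[of b] xy_set(4) x' by auto
      ultimately show False
        using ab(3) by auto
    qed
    then obtain i u where u: "i \<le> n" "u \<in> dumont1 i" "x' = map ((+) (length y)) u" "y \<in> perms (2 * (n - i))"
      using dumont_word_skew[OF dx xv(2,1) _ xv(3)] by blast
    have "length u + length y = 2 * n"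
      using u(1,2) length_perms[of u "2 * i"] length_perms[OF u(4)] by (simp add: dumont1_iff)
    then have "w = join2 u y"
      unfolding xy x' \<open>z = []\<close> join2_def u(3) by simp
    then show ?thesis
      using that(2)[of i u y] u(1,2,4) dv y_ne by (simp add: dumont1_iff)
  qed
qed

section \<open>Pattern containment in joined permutations\<close>

lemma perms_join_above:
  assumes "u \<in> perms i" "v \<in> perms j"
  shows "above (map ((+) j) u) v" "\<forall>x\<in>set (map ((+) j) u) \<union> set v. x < i + j + 1"
    "\<forall>x\<in>set (map ((+) j) u @ [i + j + 1]). x < i + j + 2"
  unfolding above_def set_append set_map_add_perms[OF assms(1)] using assms(2) by (auto simp: perms_iff)

lemma join1_perms:
  assumes "u \<in> perms i" "v \<in> perms j"
  shows "join1 u v = map ((+) j) u @ (i + j + 2) # v @ [i + j + 1]"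
  by (simp add: join1_def length_perms[OF assms(1)] length_perms[OF assms(2)])

lemma join2_perms:
  assumes "u \<in> perms i" "v \<in> perms j"
  shows "join2 u v = ((map ((+) j) u @ [i + j + 1]) @ [i + j + 2]) @ v"
  by (simp add: join2_def length_perms[OF assms(1)] length_perms[OF assms(2)])

text \<open>The insertion lemma with \<open>m = i + j + 1\<close> and \<open>M = i + j + 2\<close>;
  the shift of \<open>u\<close> does not affect patterns.\<close>

lemma contains_join1_max_last:
  assumes "u \<in> perms i" "v \<in> perms j" "\<not> decreasing_decomposable t" "\<forall>x\<in>set t. x < l"
  shows "contains_pattern (join1 u v) (t @ [l]) \<longleftrightarrow> contains_pattern u t \<or> contains_pattern v t"
  using contains_pattern_insert_max_last[OF perms_join_above(1,2)[OF assms(1,2)] _ assms(3,4)]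
  by (simp add: join1_perms[OF assms(1,2)])

lemma contains_join1_max_penultimate:
  assumes "u \<in> perms i" "v \<in> perms j" "\<forall>x\<in>set t. x < l'" "l' < l"
  shows "contains_pattern (join1 u v) (t @ [l, l']) \<longleftrightarrow> contains_pattern u t \<or> contains_pattern v (t @ [l, l'])"
  using contains_pattern_insert_max_penultimate[OF perms_join_above(1,2)[OF assms(1,2)] _ assms(3,4)]
  by (simp add: join1_perms[OF assms(1,2)])

text \<open>The two new letters belong to the upper block, so the word is again a skew sum with
  lower block \<open>v\<close>.\<close>

lemma contains_join2:
  assumes "u \<in> perms i" "v \<in> perms j" "\<not> decreasing_decomposable t"
  shows "contains_pattern (join2 u v) t \<longleftrightarrow>
    contains_pattern ((map ((+) j) u @ [i + j + 1]) @ [i + j + 2]) t \<or> contains_pattern v t"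
proof -
  have "above ((map ((+) j) u @ [i + j + 1]) @ [i + j + 2]) v"
    using perms_join_above[OF assms(1,2)] assms(2) by (auto simp: above_def perms_iff)
  then show ?thesis
    unfolding join2_perms[OF assms(1,2)] by (rule contains_pattern_skew[OF assms(3)])
qed

text \<open>The maximum absorbs \<open>l\<close>. The letter \<open>i + j + 1\<close> is kept,
  because its effect depends on whether the last letter of \<open>t\<close> is the largest of
  \<open>t\<close>.\<close>

lemma contains_join2_max_last:
  assumes "u \<in> perms i" "v \<in> perms j" "\<not> decreasing_decomposable (t @ [l])" "\<forall>x\<in>set t. x < l"
  shows "contains_pattern (join2 u v) (t @ [l]) \<longleftrightarrow>
    contains_pattern (map ((+) j) u @ [i + j + 1]) t \<or> contains_pattern v (t @ [l])"
  unfolding contains_join2[OF assms(1-3)]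
  using contains_pattern_snoc_max[OF perms_join_above(3)[OF assms(1,2)] assms(4)] by simp

lemma contains_join2_not_max:
  assumes "u \<in> perms i" "v \<in> perms j" "\<not> decreasing_decomposable t" "\<exists>x\<in>set t. last t < x"
  shows "contains_pattern (join2 u v) t \<longleftrightarrow> contains_pattern u t \<or> contains_pattern v t"
proof -
  have "\<forall>x\<in>set (map ((+) j) u). x < i + j + 1"
    using perms_join_above(2)[OF assms(1,2)] by blast
  with perms_join_above(3)[OF assms(1,2)] show ?thesis
    unfolding contains_join2[OF assms(1-3)]
    by (simp only: contains_pattern_snoc_not_max[OF _ assms(4)] contains_pattern_map_add)
qed

text \<open>Both patterns begin with their smallest letter, hence are indecomposable, and neither
  ends with its largest, so in \<open>join2\<close> the two new letters take part in no
  occurrence.\<close>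

lemma avoids_join:
  assumes "u \<in> perms i" "v \<in> perms j" "p = [1, 3, 4, 2] \<or> p = [1, 4, 2, 3]"
  shows "avoids_pattern (join1 u v) p \<longleftrightarrow> avoids_pattern u p \<and> avoids_pattern v p"
    and "avoids_pattern (join2 u v) p \<longleftrightarrow> avoids_pattern u p \<and> avoids_pattern v p"
proof -
  show "avoids_pattern (join1 u v) p \<longleftrightarrow> avoids_pattern u p \<and> avoids_pattern v p"
    using assms(3) contains_1342_insert[OF perms_join_above(1,2)[OF assms(1,2)], of "i + j + 2"]
      contains_1423_insert[OF perms_join_above(1,2)[OF assms(1,2)], of "i + j + 2"]
    unfolding avoids_pattern_def join1_perms[OF assms(1,2)] by auto
  have "\<not> decreasing_decomposable p"
    using assms(3) by (intro not_decreasing_decomposable_if_hd_le_last) auto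
  moreover have "\<exists>x\<in>set p. last p < x"
    using assms(3) by auto
  ultimately show "avoids_pattern (join2 u v) p \<longleftrightarrow> avoids_pattern u p \<and> avoids_pattern v p"
    using contains_join2_not_max[OF assms(1,2)] unfolding avoids_pattern_def by blast
qed

text \<open>The length determines \<open>i + j\<close>, and cutting at the unique letter
  \<open>i + j + 2\<close> recovers both blocks. The two joins differ in their last letter:
  \<open>i + j + 1\<close> for \<open>join1\<close>, a letter of the lower block for
  \<open>join2\<close>.\<close>

lemma join_eqD:
  assumes "u \<in> perms i" "v \<in> perms j" "u' \<in> perms i'" "v' \<in> perms j'"
  shows "join1 u v = join1 u' v' \<Longrightarrow> u = u' \<and> v = v'"
    and "join2 u v = join2 u' v' \<Longrightarrow> u = u' \<and> v = v'"
    and "v' \<noteq> [] \<Longrightarrow> join1 u v \<noteq> join2 u' v'"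
proof -
  note len = length_perms[OF assms(1)] length_perms[OF assms(2)]
    length_perms[OF assms(3)] length_perms[OF assms(4)]
  define U where "U = map ((+) j) u"
  have "\<forall>x\<in>set U \<union> set v. x < i + j + 1"
    unfolding U_def by (rule perms_join_above(2)[OF assms(1,2)])
  then have "i + j + 2 \<in> set U \<union> set v \<Longrightarrow> i + j + 2 < i + j + 1"
    by blast
  then have "i + j + 2 \<notin> set U" "i + j + 2 \<notin> set v"
    by auto
  then have notin: "i + j + 2 \<notin> set (U @ [i + j + 1])" "i + j + 2 \<notin> set U"
    "i + j + 2 \<notin> set v" "i + j + 2 \<notin> set (v @ [i + j + 1])"
    by simp_all
  {
    assume eq: "join1 u v = join1 u' v'"
    have "i + j = i' + j'"
      using arg_cong[OF eq, of length] len by simp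
    then have "U @ (i + j + 2) # v @ [i + j + 1] = map ((+) j') u' @ (i + j + 2) # v' @ [i + j + 1]"
      using eq unfolding join1_perms[OF assms(1,2)] join1_perms[OF assms(3,4)] U_def by simp
    then have "U = map ((+) j') u'" "v = v'"
      unfolding append_Cons_eq_iff[OF notin(2,4)] by simp_all
    moreover from this(2) have "j = j'"
      using len by simp
    ultimately show "u = u' \<and> v = v'"
      unfolding U_def by (simp add: inj_map_eq_map)
  }
  {
    assume eq: "join2 u v = join2 u' v'"
    have "i + j = i' + j'"
      using arg_cong[OF eq, of length] len by simp
    then have "(U @ [i + j + 1]) @ (i + j + 2) # v = (map ((+) j') u' @ [i + j + 1]) @ (i + j + 2) # v'"
      using eq unfolding join2_perms[OF assms(1,2)] join2_perms[OF assms(3,4)] U_def by simp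
    then have "U = map ((+) j') u'" "v = v'"
      unfolding append_Cons_eq_iff[OF notin(1,3)] by simp_all
    moreover from this(2) have "j = j'"
      using len by simp
    ultimately show "u = u' \<and> v = v'"
      unfolding U_def by (simp add: inj_map_eq_map)
  }
  assume "v' \<noteq> []"
  show "join1 u v \<noteq> join2 u' v'"
  proof
    assume eq: "join1 u v = join2 u' v'"
    have "i + j = i' + j'"
      using arg_cong[OF eq, of length] len by simp
    moreover have "last v' = i + j + 1"
      using arg_cong[OF eq, of last] \<open>v' \<noteq> []\<close> len by (simp add: join1_def join2_def)
    moreover have "last v' \<le> j'"
      using last_in_set[OF \<open>v' \<noteq> []\<close>] assms(4) by (auto simp: perms_iff)
    ultimately show False
      by simp
  qed
qed

text \<open>Reading the sizes off the lengths puts pairs of all sizes into one domain, so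
  injectivity and disjointness hold for the whole union over \<open>i\<close> at once.\<close>

lemma join_inj_on:
  defines "S \<equiv> {(u, v). u \<in> perms (length u) \<and> v \<in> perms (length v)}"
  shows "inj_on (case_prod join1) S" "inj_on (case_prod join2) S"
    and "case_prod join1 ` S \<inter> case_prod join2 ` (S - UNIV \<times> {[]}) = {}"
proof -
  show "inj_on (case_prod join1) S"
    unfolding S_def inj_on_def using join_eqD(1) by auto
  show "inj_on (case_prod join2) S"
    unfolding S_def inj_on_def using join_eqD(2) by auto
  show "case_prod join1 ` S \<inter> case_prod join2 ` (S - UNIV \<times> {[]}) = {}"
  proof -
    have "join1 u v \<noteq> join2 u' v'" if "(u, v) \<in> S" "(u', v') \<in> S" "v' \<noteq> []" for u v u' v'
      using that join_eqD(3)[of u _ v _ u' _ v'] unfolding S_def by blast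
    then show ?thesis
      by (clarsimp simp: disjoint_iff) metis
  qed
qed

section \<open>Generating functions\<close>

definition avoiders :: "nat list \<Rightarrow> nat \<Rightarrow> nat list set" where
  "avoiders \<tau> n = dumont1_avoiding n {[1, 3, 4, 2], [1, 4, 2, 3], \<tau>}"

lemma avoiders_iff:
  "w \<in> avoiders \<tau> n \<longleftrightarrow> w \<in> dumont1 n \<and> avoids_pattern w [1, 3, 4, 2] \<and>
     avoids_pattern w [1, 4, 2, 3] \<and> avoids_pattern w \<tau>"
  by (simp add: avoiders_def dumont1_avoiding_def)

lemma finite_avoiders: "finite (avoiders \<tau> n)"
proof (rule finite_subset)
  show "avoiders \<tau> n \<subseteq> perms (2 * n)"
    by (auto simp: avoiders_iff dumont1_iff)
qed (simp add: perms_def)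

lemma avoiders_perms: "w \<in> avoiders \<tau> n \<Longrightarrow> w \<in> perms (2 * n)"
  by (simp add: avoiders_iff dumont1_iff)

lemma avoiders_0: "\<tau> \<noteq> [] \<Longrightarrow> avoiders \<tau> 0 = {[]}"
  by (auto simp: avoiders_iff dumont1_iff perms_iff dumont_word_def avoids_pattern_def)

lemma Nil_in_avoiders: "[] \<in> avoiders \<tau> n \<Longrightarrow> n = 0"
  using avoiders_perms[of "[]"] length_perms[of "[]"] by fastforce

lemma avoid_gf_nth: "avoid_gf \<tau> $ n = real (card (avoiders \<tau> n))"
  by (simp add: avoid_gf_def avoiders_def)

text \<open>The parameters \<open>\<tau>1\<close>, \<open>\<tau>2\<close>, \<open>\<tau>3\<close>
  isolate what depends on the shape of the pattern; the lower block of \<open>join2\<close> always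
  has to avoid \<open>\<tau>\<close> itself.\<close>

lemma avoiders_Suc:
  assumes "\<tau> \<noteq> []"
    and j1: "\<And>i j u v. u \<in> dumont1 i \<Longrightarrow> v \<in> dumont1 j \<Longrightarrow>
      contains_pattern (join1 u v) \<tau> \<longleftrightarrow> contains_pattern u \<tau>1 \<or> contains_pattern v \<tau>2"
    and j2: "\<And>i j u v. u \<in> dumont1 i \<Longrightarrow> v \<in> dumont1 j \<Longrightarrow> v \<noteq> [] \<Longrightarrow>
      contains_pattern (join2 u v) \<tau> \<longleftrightarrow> contains_pattern u \<tau>3 \<or> contains_pattern v \<tau>"
  shows "avoiders \<tau> (Suc n) =
    case_prod join1 ` (\<Union>i\<le>n. avoiders \<tau>1 i \<times> avoiders \<tau>2 (n - i)) \<union>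
    case_prod join2 ` (\<Union>i\<le>n. avoiders \<tau>3 i \<times> (avoiders \<tau> (n - i) - {[]}))"
    (is "_ = ?A \<union> ?B")
proof (intro equalityI subsetI)
  fix w assume w: "w \<in> avoiders \<tau> (Suc n)"
  then have wd: "w \<in> dumont1 (Suc n)" and av: "avoids_pattern w [1, 3, 4, 2]" "avoids_pattern w [1, 4, 2, 3]"
    and av': "avoids_pattern w \<tau>"
    by (auto simp: avoiders_iff)
  show "w \<in> ?A \<union> ?B"
    using wd av
  proof (cases rule: dumont1_SucE)
    case (1 i u v)
    have p: "u \<in> perms (2 * i)" "v \<in> perms (2 * (n - i))"
      using 1 by (simp_all add: dumont1_iff)
    have "u \<in> avoiders \<tau>1 i" "v \<in> avoiders \<tau>2 (n - i)"
      using 1 av av' avoids_join(1)[OF p] j1[OF 1(2,3)] by (auto simp: avoiders_iff avoids_pattern_def)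
    with 1 show ?thesis by auto
  next
    case (2 i u v)
    have p: "u \<in> perms (2 * i)" "v \<in> perms (2 * (n - i))"
      using 2 by (simp_all add: dumont1_iff)
    have "u \<in> avoiders \<tau>3 i" "v \<in> avoiders \<tau> (n - i)"
      using 2 av av' avoids_join(2)[OF p] j2[OF 2(2,3,4)] by (auto simp: avoiders_iff avoids_pattern_def)
    with 2 show ?thesis by auto
  qed
next
  fix w assume "w \<in> ?A \<union> ?B"
  then show "w \<in> avoiders \<tau> (Suc n)"
  proof
    assume "w \<in> ?A"
    then obtain i u v where w: "i \<le> n" "u \<in> avoiders \<tau>1 i" "v \<in> avoiders \<tau>2 (n - i)" "w = join1 u v"
      by auto
    then have d: "u \<in> dumont1 i" "v \<in> dumont1 (n - i)"
      by (auto simp: avoiders_iff)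
    show ?thesis
      using w avoids_join(1)[OF avoiders_perms[OF w(2)] avoiders_perms[OF w(3)]] j1[OF d] joins_in_dumont1(1)[OF d]
      by (auto simp: avoiders_iff avoids_pattern_def)
  next
    assume "w \<in> ?B"
    then obtain i u v where w: "i \<le> n" "u \<in> avoiders \<tau>3 i" "v \<in> avoiders \<tau> (n - i)" "v \<noteq> []" "w = join2 u v"
      by auto
    then have d: "u \<in> dumont1 i" "v \<in> dumont1 (n - i)"
      by (auto simp: avoiders_iff)
    show ?thesis
      using w avoids_join(2)[OF avoiders_perms[OF w(2)] avoiders_perms[OF w(3)]] j2[OF d w(4)] joins_in_dumont1(2)[OF d w(4)]
      by (auto simp: avoiders_iff avoids_pattern_def)
  qed
qed

text \<open>The length of the first component determines \<open>i\<close>, so the union is disjoint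
  and its size is a convolution.\<close>

lemma card_UN_prod_perms:
  assumes "\<And>i. finite (X i)" "\<And>i. finite (Y i)" "\<And>i w. w \<in> X i \<Longrightarrow> w \<in> perms (2 * i)"
  shows "card (\<Union>i\<le>n. X i \<times> Y (n - i)) = (\<Sum>i=0..n. card (X i) * card (Y (n - i)))"
proof -
  have "card (\<Union>i\<le>n. X i \<times> Y (n - i)) = (\<Sum>i\<le>n. card (X i \<times> Y (n - i)))"
  proof (rule card_UN_disjoint)
    have "i = j" if "w \<in> X i" "w \<in> X j" for w i j
      using length_perms[OF assms(3)[OF that(1)]] length_perms[OF assms(3)[OF that(2)]] by simp
    then show "\<forall>i\<in>{..n}. \<forall>j\<in>{..n}. i \<noteq> j \<longrightarrow> X i \<times> Y (n - i) \<inter> X j \<times> Y (n - j) = {}"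
      by blast
  qed (use assms in auto)
  then show ?thesis
    by (simp add: card_cartesian_product atMost_atLeast0)
qed

lemma avoid_gf_rec:
  assumes "\<tau> \<noteq> []"
    and j1: "\<And>i j u v. u \<in> dumont1 i \<Longrightarrow> v \<in> dumont1 j \<Longrightarrow>
      contains_pattern (join1 u v) \<tau> \<longleftrightarrow> contains_pattern u \<tau>1 \<or> contains_pattern v \<tau>2"
    and j2: "\<And>i j u v. u \<in> dumont1 i \<Longrightarrow> v \<in> dumont1 j \<Longrightarrow> v \<noteq> [] \<Longrightarrow>
      contains_pattern (join2 u v) \<tau> \<longleftrightarrow> contains_pattern u \<tau>3 \<or> contains_pattern v \<tau>"
  shows "avoid_gf \<tau> =
    1 + fps_X * (avoid_gf \<tau>1 * avoid_gf \<tau>2 + avoid_gf \<tau>3 * (avoid_gf \<tau> - 1))"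
proof (rule fps_ext)
  fix n
  \<comment> \<open>Subtracting 1 accounts for the nonempty lower block of \<open>join2\<close>: the
    empty word is counted only at size 0.\<close>
  have minus1: "(avoid_gf \<tau> - 1) $ k = real (card (avoiders \<tau> k - {[]}))" for k
  proof (cases k)
    case 0
    then show ?thesis
      using assms(1) by (simp add: avoid_gf_nth avoiders_0)
  next
    case (Suc k')
    then have "[] \<notin> avoiders \<tau> k"
      using Nil_in_avoiders by blast
    with Suc show ?thesis
      by (simp add: avoid_gf_nth)
  qed
  show "avoid_gf \<tau> $ n =
    (1 + fps_X * (avoid_gf \<tau>1 * avoid_gf \<tau>2 + avoid_gf \<tau>3 * (avoid_gf \<tau> - 1))) $ n"
  proof (cases n)
    case 0
    then show ?thesis
      using assms(1) by (simp add: avoid_gf_nth avoiders_0)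
  next
    case (Suc k)
    let ?P = "\<Union>i\<le>k. avoiders \<tau>1 i \<times> avoiders \<tau>2 (k - i)"
    let ?Q = "\<Union>i\<le>k. avoiders \<tau>3 i \<times> (avoiders \<tau> (k - i) - {[]})"
    have fin: "finite ?P" "finite ?Q"
      by (auto simp: finite_avoiders)
    let ?S = "{(u, v). u \<in> perms (length u) \<and> v \<in> perms (length v)}"
    have "w \<in> perms (length w)" if "w \<in> avoiders t i" for w t i
      using avoiders_perms[OF that] length_perms[OF avoiders_perms[OF that]] by simp
    then have sub: "?P \<subseteq> ?S" "?Q \<subseteq> ?S - UNIV \<times> {[]}"
      by auto
    have inj: "inj_on (case_prod join1) ?P" "inj_on (case_prod join2) ?Q"
      using inj_on_subset[OF join_inj_on(1) sub(1)] inj_on_subset[OF join_inj_on(2), of ?Q] sub(2) by auto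
    have disj: "case_prod join1 ` ?P \<inter> case_prod join2 ` ?Q = {}"
      using join_inj_on(3) sub by blast
    have "card (avoiders \<tau> n) = card (case_prod join1 ` ?P) + card (case_prod join2 ` ?Q)"
    proof -
      have "avoiders \<tau> (Suc k) = case_prod join1 ` ?P \<union> case_prod join2 ` ?Q"
        by (rule avoiders_Suc[OF assms(1)]) (rule j1 j2; assumption)+
      then show ?thesis
        unfolding Suc using fin disj by (simp add: card_Un_disjoint)
    qed
    also have "\<dots> = card ?P + card ?Q"
      by (simp only: card_image[OF inj(1)] card_image[OF inj(2)])
    also have "card ?P = (\<Sum>i=0..k. card (avoiders \<tau>1 i) * card (avoiders \<tau>2 (k - i)))"
      by (intro card_UN_prod_perms finite_avoiders avoiders_perms)
    also have "card ?Q = (\<Sum>i=0..k. card (avoiders \<tau>3 i) * card (avoiders \<tau> (k - i) - {[]}))"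
      by (intro card_UN_prod_perms[where Y = "\<lambda>i. avoiders \<tau> i - {[]}"] finite_avoiders finite_Diff avoiders_perms)
    finally have card: "card (avoiders \<tau> n) =
        (\<Sum>i=0..k. card (avoiders \<tau>1 i) * card (avoiders \<tau>2 (k - i))) +
        (\<Sum>i=0..k. card (avoiders \<tau>3 i) * card (avoiders \<tau> (k - i) - {[]}))" .
    have "(1 + fps_X * (avoid_gf \<tau>1 * avoid_gf \<tau>2 + avoid_gf \<tau>3 * (avoid_gf \<tau> - 1))) $ n =
        (avoid_gf \<tau>1 * avoid_gf \<tau>2) $ k + (avoid_gf \<tau>3 * (avoid_gf \<tau> - 1)) $ k"
      by (simp add: Suc)
    also have "\<dots> = real (card (avoiders \<tau> n))"
      unfolding fps_mult_nth minus1 avoid_gf_nth card by simp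
    finally show ?thesis
      by (simp add: avoid_gf_nth)
  qed
qed

text \<open>The maximum \<open>2 * j\<close> is even, so it has a smaller successor.\<close>

lemma contains_21:
  assumes "v \<in> dumont1 j" "v \<noteq> []"
  shows "contains_pattern v [2, 1]"
proof -
  have v: "v \<in> perms (2 * j)" "dumont_word v"
    using assms(1) by (simp_all add: dumont1_iff)
  have "2 * j \<in> set v"
    using v(1) assms(2) by (cases j) (auto simp: perms_iff)
  then obtain x y where xy: "v = x @ (2 * j) # y"
    by (meson split_list)
  then have "y \<noteq> []"
    using v(2) by (auto simp: dumont_word_def)
  then obtain c y' where y: "y = c # y'"
    by (cases y) auto
  then have "c < 2 * j"
    using v(2) xy by (simp add: dumont_word_def successively_append_iff dumont_step_def)
  then have "order_iso [2 * j, c] [2, 1]"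
    by (auto simp: order_iso_def less_Suc_eq nth_Cons')
  moreover have "subseq [2 * j, c] v"
    unfolding xy y by (rule subseq_drop_many) simp
  ultimately show ?thesis
    unfolding contains_pattern_iff_subseq by blast
qed

section \<open>Solving the functional equations\<close>

lemma fps_sqrt_power2:
  fixes f :: "real fps"
  assumes "f $ 0 = 1"
  shows "fps_sqrt (f\<^sup>2) = f"
proof -
  \<comment> \<open>A power series root with nonzero constant term is determined by that term; here
    it is 1 on both sides.\<close>
  have "f ^ Suc 1 = f\<^sup>2 \<longleftrightarrow> f = fps_radical root (Suc 1) (f\<^sup>2)"
    by (rule radical_unique) (use assms in \<open>simp_all add: fps_power_zeroth\<close>)
  then show ?thesis
    unfolding fps_sqrt_def by (simp add: numeral_2_eq_2)
qed

text \<open>Completing the square gives the discriminant as the square of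
  \<open>B - 2 * fps_X * A\<close>. This series has constant term 1, which selects the branch of the
  root, and the division by \<open>2 * fps_X\<close> is exact.\<close>

lemma fps_quadratic_solution:
  fixes A B :: "real fps"
  assumes "fps_X * A\<^sup>2 - B * A + 1 = 0" "B $ 0 = 1"
  shows "A = (B - fps_sqrt (B\<^sup>2 - 4 * fps_X)) / (2 * fps_X)"
proof -
  have "(B - 2 * fps_X * A)\<^sup>2 = B\<^sup>2 - 4 * fps_X + 4 * fps_X * (fps_X * A\<^sup>2 - B * A + 1)"
    by (simp add: power2_eq_square algebra_simps)
  then have "B\<^sup>2 - 4 * fps_X = (B - 2 * fps_X * A)\<^sup>2"
    unfolding assms(1) by simp
  moreover have "(B - 2 * fps_X * A) $ 0 = 1"
    using assms(2) by (simp add: mult.assoc)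
  ultimately have "B - fps_sqrt (B\<^sup>2 - 4 * fps_X) = A * (2 * fps_X)"
    by (simp add: fps_sqrt_power2)
  then show ?thesis
    by (metis nonzero_mult_div_cancel_right mult_eq_0_iff fps_X_neq_zero zero_neq_numeral)
qed

lemma fps_linear_solution:
  fixes A B C :: "real fps"
  assumes "A = 1 + fps_X * (B\<^sup>2 + C * (A - 1))"
  shows "A = 1 + fps_X * B\<^sup>2 / (1 - fps_X * C)"
proof -
  have "(1 - fps_X * C) $ 0 = 1"
    by simp
  then have "1 - fps_X * C \<noteq> 0"
    by (metis fps_zero_nth zero_neq_one)
  moreover have "fps_X * B\<^sup>2 = (A - 1) * (1 - fps_X * C)"
  proof -
    have "A - 1 = fps_X * (B\<^sup>2 + C * (A - 1))"
      using assms by (metis add_diff_cancel_left')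
    then show ?thesis
      by (simp add: algebra_simps)
  qed
  ultimately have "fps_X * B\<^sup>2 / (1 - fps_X * C) = A - 1"
    by (metis nonzero_mult_div_cancel_right)
  then show ?thesis
    by simp
qed

section \<open>The three shapes of \<tau>\<close>

lemma avoid_gf_max_last:
  assumes t: "t \<in> perms (l - 1)" "l \<ge> 2" "\<not> decreasing_decomposable t" "t ! (l - 2) \<noteq> l - 1"
  shows "avoid_gf (t @ [l]) = 1 + fps_X * (avoid_gf t)\<^sup>2 / (1 - fps_X * avoid_gf t)"
proof (rule fps_linear_solution)
  have len: "length t = l - 1"
    using length_perms[OF t(1)] .
  then have ne: "t \<noteq> []"
    using t(2) by auto
  have lt: "\<forall>x\<in>set t. x < l"
    using t(1,2) by (auto simp: perms_iff)
  \<comment> \<open>Positions are counted from 0, so \<open>l - 2\<close> is the last position of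
    \<open>t\<close>; its largest letter \<open>l - 1\<close> therefore stands earlier.\<close>
  have "last t \<noteq> l - 1"
    using t(4) ne len by (simp add: last_conv_nth numeral_2_eq_2)
  moreover have "last t \<in> {1..l - 1}" and l1: "l - 1 \<in> set t"
    using last_in_set[OF ne] t(1,2) by (auto simp: perms_iff)
  ultimately have not_max: "\<exists>x\<in>set t. last t < x"
    by (intro bexI[of _ "l - 1"]) auto
  have nd: "\<not> decreasing_decomposable (t @ [l])"
    using lt ne by (intro not_decreasing_decomposable_if_hd_le_last) (simp add: less_imp_le)
  have "avoid_gf (t @ [l]) = 1 + fps_X * (avoid_gf t * avoid_gf t + avoid_gf t * (avoid_gf (t @ [l]) - 1))"
  proof (rule avoid_gf_rec)
    fix i j u v assume "u \<in> dumont1 i" "v \<in> dumont1 j"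
    then have p: "u \<in> perms (2 * i)" "v \<in> perms (2 * j)"
      by (simp_all add: dumont1_iff)
    show "contains_pattern (join1 u v) (t @ [l]) \<longleftrightarrow> contains_pattern u t \<or> contains_pattern v t"
      by (rule contains_join1_max_last[OF p t(3) lt])
    \<comment> \<open>The maximum plays \<open>l\<close>, and the remaining \<open>i + j + 1\<close>
      cannot end an occurrence of \<open>t\<close>, whose last letter is not its largest.\<close>
    show "contains_pattern (join2 u v) (t @ [l]) \<longleftrightarrow> contains_pattern u t \<or> contains_pattern v (t @ [l])"
      using contains_join2_max_last[OF p nd lt] perms_join_above(2)[OF p] contains_pattern_snoc_not_max[OF _ not_max]
      by simp
  qed simp
  then show "avoid_gf (t @ [l]) = 1 + fps_X * ((avoid_gf t)\<^sup>2 + avoid_gf t * (avoid_gf (t @ [l]) - 1))"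
    by (simp add: power2_eq_square)
qed

lemma avoid_gf_last_two_max:
  assumes t: "t \<in> perms (l - 2)" "l \<ge> 2"
  shows "avoid_gf (t @ [l - 1, l]) =
    1 + fps_X * (avoid_gf (t @ [l - 1]))\<^sup>2 / (1 - fps_X * avoid_gf t)"
proof (rule fps_linear_solution)
  let ?s = "t @ [l - 1]"
  have lt: "\<forall>x\<in>set t. x < l - 1" "\<forall>x\<in>set ?s. x < l"
    using t by (auto simp: perms_iff)
  \<comment> \<open>Both words end with their largest letter, which makes them indecomposable for
    every \<open>t\<close>, including the empty one.\<close>
  have nd: "\<not> decreasing_decomposable ?s" "\<not> decreasing_decomposable (?s @ [l])"
    using lt by (cases t; auto intro!: not_decreasing_decomposable_if_hd_le_last)+
  have "avoid_gf (?s @ [l]) = 1 + fps_X * (avoid_gf ?s * avoid_gf ?s + avoid_gf t * (avoid_gf (?s @ [l]) - 1))"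
  proof (rule avoid_gf_rec)
    fix i j u v assume "u \<in> dumont1 i" "v \<in> dumont1 j"
    then have p: "u \<in> perms (2 * i)" "v \<in> perms (2 * j)"
      by (simp_all add: dumont1_iff)
    show "contains_pattern (join1 u v) (?s @ [l]) \<longleftrightarrow> contains_pattern u ?s \<or> contains_pattern v ?s"
      by (rule contains_join1_max_last[OF p nd(1) lt(2)])
    \<comment> \<open>The two new letters are adjacent and increasing, so they absorb both
      \<open>l - 1\<close> and \<open>l\<close>, leaving \<open>t\<close> for
      \<open>u\<close>.\<close>
    show "contains_pattern (join2 u v) (?s @ [l]) \<longleftrightarrow> contains_pattern u t \<or> contains_pattern v (?s @ [l])"
      using contains_join2_max_last[OF p nd(2) lt(2)] perms_join_above(2)[OF p] contains_pattern_snoc_max[OF _ lt(1)]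
      by simp
  qed simp
  then show "avoid_gf (t @ [l - 1, l]) =
      1 + fps_X * ((avoid_gf ?s)\<^sup>2 + avoid_gf t * (avoid_gf (t @ [l - 1, l]) - 1))"
    by (simp add: power2_eq_square)
qed

text \<open>Here \<tau> itself is imposed on the lower block of \<open>join1\<close> and on the
  upper block of \<open>join2\<close>, so the unknown series is multiplied by itself and the
  equation becomes quadratic.\<close>

lemma avoid_gf_max_penultimate:
  assumes t: "t \<in> perms (l - 2)" "l \<ge> 2"
  shows "avoid_gf (t @ [l, l - 1]) =
    (1 + fps_X * (1 - avoid_gf t) - fps_sqrt ((1 + fps_X * (1 - avoid_gf t))\<^sup>2 - 4 * fps_X)) / (2 * fps_X)"
proof (rule fps_quadratic_solution)
  let ?s = "t @ [l, l - 1]"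
  have lt: "\<forall>x\<in>set t. x < l - 1" "l - 1 < l"
    using t by (auto simp: perms_iff)
  have not_max: "\<exists>x\<in>set ?s. last ?s < x"
    using lt(2) by simp
  have "avoid_gf ?s = 1 + fps_X * (avoid_gf t * avoid_gf ?s + avoid_gf ?s * (avoid_gf ?s - 1))"
  proof (rule avoid_gf_rec)
    fix i j u v assume d: "u \<in> dumont1 i" "v \<in> dumont1 j"
    then have p: "u \<in> perms (2 * i)" "v \<in> perms (2 * j)"
      by (simp_all add: dumont1_iff)
    show "contains_pattern (join1 u v) ?s \<longleftrightarrow> contains_pattern u t \<or> contains_pattern v ?s"
      by (rule contains_join1_max_penultimate[OF p lt])
    assume "v \<noteq> []"
    show "contains_pattern (join2 u v) ?s \<longleftrightarrow> contains_pattern u ?s \<or> contains_pattern v ?s"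
    \<comment> \<open>For empty \<open>t\<close> the pattern is 21, which is decomposable, so the
      skew argument fails. Instead both sides are true, since every nonempty Dumont permutation
      contains 21.\<close>
    proof (cases "t = []")
      case True
      then have "l = 2"
        using length_perms[OF t(1)] t(2) by simp
      then have "?s = [2, 1]"
        using True by simp
      moreover have "contains_pattern v [2, 1]" "contains_pattern (join2 u v) [2, 1]"
        using contains_21 joins_in_dumont1(2)[OF d \<open>v \<noteq> []\<close>] d(2) \<open>v \<noteq> []\<close>
        by (auto simp: join2_def)
      ultimately show ?thesis
        by simp
    next
      case False
      then have "\<not> decreasing_decomposable ?s"
        using lt(1) by (intro not_decreasing_decomposable_if_hd_le_last) (simp add: less_imp_le)
      then show ?thesis
        using contains_join2_not_max[OF p _ not_max] by blast
    qed
  qed simp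
  then show "fps_X * (avoid_gf ?s)\<^sup>2 - (1 + fps_X * (1 - avoid_gf t)) * avoid_gf ?s + 1 = 0"
    by (simp add: algebra_simps power2_eq_square)
qed simp

theorem theorem4p2:
  shows "(\<forall>l \<tau>'. l \<ge> 2 \<longrightarrow> \<tau>' \<in> perms (l - 1) \<longrightarrow> \<not> decreasing_decomposable \<tau>' \<longrightarrow>
            \<tau>' ! (l - 2) \<noteq> l - 1 \<longrightarrow>
            avoid_gf (\<tau>' @ [l]) =
              1 + fps_X * (avoid_gf \<tau>')^2 / (1 - fps_X * avoid_gf \<tau>'))
       \<and> (\<forall>l \<tau>'. l \<ge> 2 \<longrightarrow> \<tau>' \<in> perms (l - 2) \<longrightarrow>
            avoid_gf (\<tau>' @ [l - 1, l]) =
              1 + fps_X * (avoid_gf (\<tau>' @ [l - 1]))^2 / (1 - fps_X * avoid_gf \<tau>'))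
       \<and> (\<forall>l \<tau>'. l \<ge> 2 \<longrightarrow> \<tau>' \<in> perms (l - 2) \<longrightarrow>
            avoid_gf (\<tau>' @ [l, l - 1]) =
              (1 + fps_X * (1 - avoid_gf \<tau>')
                 - fps_sqrt ((1 + fps_X * (1 - avoid_gf \<tau>'))^2 - 4 * fps_X))
              / (2 * fps_X))"
  using avoid_gf_max_last avoid_gf_last_two_max avoid_gf_max_penultimate by blast

end
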